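(* Let $m_1,m_2,m_3>0$ with $m_1+m_2+m_3=1$, $m_4=0$, and let $a_1,a_2,a_3,a_4\in\mathbb R^2$ be a normalized central configuration of the restricted $4$-body problem with constant $\mu$. Suppose that $a_1,a_2,a_3$ form an Euler collinear configuration and that $a_1,a_2,a_3,a_4$ span $\mathbb R^2$. Then the eigenvalues $\lambda_3$ and $\lambda_4$ of the matrix $$D=I_2-\frac1\mu\left(\sum_{i=1}^{3}\frac{m_i}{|a_i-a_4|^3}\right)I_2+\frac3\mu\sum_{i=1}^{3}m_i\frac{(a_i-a_4)(a_i-a_4)^T}{|a_i-a_4|^5}$$ are both positive and satisfy $\lambda_3+\lambda_4=3$.
   Context: Normalized central configuration of the restricted $4$-body problem: the points $a_1,\dots,a_4$ are pairwise distinct, $\sum_{i=1}^3m_i|a_i|^2=1$, $\mu=\sum_{1\le i<j\le3}\frac{m_im_j}{|a_i-a_j|}$, and $\sum_{1\le j\le3,\,j\ne i}\frac{m_j(a_j-a_i)}{|a_j-a_i|^3}=-\mu a_i$ for $i=1,2,3,4$ (the fourth body is massless, so the sum for $i=4$ is over $j=1,2,3$). An Euler collinear configuration is a central configuration of three positive masses lying on a line; "span $\mathbb R^2$" means that the four points are not collinear. $I_2$ is the $2\times 2$ identity matrix. *)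

theory Defs
  imports "HOL-Analysis.Analysis" "HOL-Computational_Algebra.Polynomial"
begin

text \<open>
  Bodies are numbered \<open>1, \<dots>, N\<close>; only the first \<open>M\<close> of them carry mass, so only they exert a
  force and enter the normalization and the constant \<open>\<mu>\<close>. The restricted 4-body problem is
  \<open>M = 3\<close>, \<open>N = 4\<close>; the 3-body problem is \<open>M = N = 3\<close>.
\<close>

definition normalized_central_configuration ::
    "nat \<Rightarrow> nat \<Rightarrow> (nat \<Rightarrow> real) \<Rightarrow> real \<Rightarrow> (nat \<Rightarrow> real^2) \<Rightarrow> bool" where
  "normalized_central_configuration M N m \<mu> a \<longleftrightarrow>
     inj_on a {1..N} \<and>
     (\<Sum>i=1..M. m i * (norm (a i))\<^sup>2) = 1 \<and>
     \<mu> = (\<Sum>i=1..M. \<Sum>j\<in>{i<..M}. m i * m j / norm (a i - a j)) \<and>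
     (\<forall>i\<in>{1..N}.
        (\<Sum>j\<in>{1..M} - {i}. (m j / norm (a j - a i) ^ 3) *\<^sub>R (a j - a i)) = - (\<mu> *\<^sub>R a i))"

definition euler_configuration :: "(nat \<Rightarrow> real) \<Rightarrow> (nat \<Rightarrow> real^2) \<Rightarrow> bool" where
  "euler_configuration m a \<longleftrightarrow>
     (\<forall>i\<in>{1..3}. m i > 0) \<and>
     (\<exists>\<mu>. normalized_central_configuration 3 3 m \<mu> a) \<and>
     collinear (a ` {1..3})"

definition matrix_D :: "(nat \<Rightarrow> real) \<Rightarrow> real \<Rightarrow> (nat \<Rightarrow> real^2) \<Rightarrow> real^2^2" where
  "matrix_D m \<mu> a =
     mat 1
     - (1 / \<mu> * (\<Sum>i=1..3. m i / norm (a i - a 4) ^ 3)) *\<^sub>R mat 1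
     + (3 / \<mu>) *\<^sub>R (\<Sum>i=1..3. (m i / norm (a i - a 4) ^ 5) *\<^sub>R
         ((columnvector (a i - a 4) :: real^1^2) ** rowvector (a i - a 4)))"

definition eigenvalue :: "'a::field^'n^'n \<Rightarrow> 'a \<Rightarrow> bool" where
  "eigenvalue A c \<longleftrightarrow> (\<exists>v. v \<noteq> 0 \<and> A *v v = c *s v)"

definition char_poly :: "'a::field^'n^'n \<Rightarrow> 'a poly" where
  "char_poly A = det (mat [:0, 1:] - map_matrix (\<lambda>c. [:c:]) A)"

text \<open>
  \<open>S\<close> is the multiset of all eigenvalues of \<open>A\<close> in the field \<open>'a\<close>, each counted with its algebraic
  multiplicity. If \<open>size S\<close> is the dimension, then \<open>A\<close> has no further eigenvalues in any
  extension field.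
\<close>

definition has_eigenvalues :: "'a::field^'n^'n \<Rightarrow> 'a multiset \<Rightarrow> bool" where
  "has_eigenvalues A S \<longleftrightarrow>
     (\<forall>c. count S c = (if eigenvalue A c then order c (char_poly A) else 0))"

end

theory Submission
  imports Defs
begin

text \<open>
  The component of the equilibrium equation of a primary normal to the Euler line shows that the
  line passes through the origin. The same component of the equation of the massless body, which
  lies off the line, then gives \<open>\<Sum>\<^sub>i m\<^sub>i / |a\<^sub>i - a\<^sub>4|\<^sup>3 = \<mu>\<close>. Hence the identity terms of \<open>D\<close> cancel,
  and \<open>D\<close> is a positive combination of the rank one matrices of the vectors \<open>a\<^sub>i - a\<^sub>4\<close>: its trace
  is \<open>3\<close>, and it is positive definite because these vectors span the plane.
\<close>

text \<open>In the plane, affine dimension at most one amounts to lying in a hyperplane. The normal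
  \<open>n\<close> turns collinearity into a linear equation that can be paired with the equilibrium
  equations.\<close>

lemma collinear_iff_hyperplane_2:
  fixes S :: "(real^2) set"
  shows "collinear S \<longleftrightarrow> (\<exists>n b. n \<noteq> 0 \<and> S \<subseteq> {x. n \<bullet> x = b})"
proof
  assume "collinear S"
  then have "aff_dim S < int DIM(real^2)"
    by (simp add: collinear_aff_dim)
  then show "\<exists>n b. n \<noteq> 0 \<and> S \<subseteq> {x. n \<bullet> x = b}"
    by (metis aff_lowdim_subset_hyperplane)
next
  assume "\<exists>n b. n \<noteq> 0 \<and> S \<subseteq> {x. n \<bullet> x = b}"
  then obtain n b where n: "n \<noteq> 0" "S \<subseteq> {x. n \<bullet> x = b}" by blast
  show "collinear S"
    using aff_dim_subset[OF n(2)] n(1) by (simp add: collinear_aff_dim)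
qed

lemma char_poly_2:
  fixes A :: "'a::field^2^2"
  shows "char_poly A = [: A$1$1 * A$2$2 - A$1$2 * A$2$1, - trace A, 1 :]"
  by (simp add: char_poly_def det_2 mat_def map_matrix_def trace_def sum_2 algebra_simps)

lemma eigenvalue_if_root_2:
  fixes A :: "real^2^2"
  assumes "poly (char_poly A) c = 0"
  shows "eigenvalue A c"
proof -
  have "det (A - c *\<^sub>R mat 1) = 0"
    using assms by (simp add: char_poly_2 det_2 mat_def trace_def sum_2 algebra_simps)
  then obtain v where v: "v \<noteq> 0" "(A - c *\<^sub>R mat 1) *v v = 0"
    by (metis invertible_det_nz invertible_left_inverse matrix_left_invertible_ker)
  have "(c *\<^sub>R mat 1 :: real^2^2) *v v = c *s v"
    by (simp add: scaleR_matrix_vector_assoc[symmetric] scalar_mult_eq_scaleR)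
  with v show ?thesis
    unfolding eigenvalue_def by (metis eq_iff_diff_eq_0 matrix_vector_mult_diff_rdistrib)
qed

text \<open>Root orders add over the two linear factors, so they reproduce the multiset count, also
  when the roots coincide. The eigenvalue test in \<open>has_eigenvalues\<close> does no harm: every
  root has an eigenvector, and any other \<open>c\<close> has count zero.\<close>

lemma has_eigenvalues_2:
  fixes A :: "real^2^2"
  assumes fac: "char_poly A = [:- l\<^sub>1, 1:] * [:- l\<^sub>2, 1:]"
  shows "has_eigenvalues A {#l\<^sub>1, l\<^sub>2#}"
  unfolding has_eigenvalues_def
proof
  fix c
  have ord1: "order c [:- l, 1:] = (if c = l then 1 else 0)" for l :: real
    using order_power_n_n[of l 1] by (auto intro: order_0I)
  have "order c (char_poly A) = order c [:- l\<^sub>1, 1:] + order c [:- l\<^sub>2, 1:]"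
    unfolding fac by (rule order_mult) simp
  then have "count {#l\<^sub>1, l\<^sub>2#} c = order c (char_poly A)"
    by (simp add: ord1)
  moreover have "eigenvalue A c" if "c \<in> {l\<^sub>1, l\<^sub>2}"
    using that by (intro eigenvalue_if_root_2) (auto simp: fac)
  moreover have "count {#l\<^sub>1, l\<^sub>2#} c = 0" if "c \<notin> {l\<^sub>1, l\<^sub>2}"
    using that by simp
  ultimately show "count {#l\<^sub>1, l\<^sub>2#} c = (if eigenvalue A c then order c (char_poly A) else 0)"
    by presburger
qed

lemma symmetric_positive_definite_2_eigenvalues:
  fixes A :: "real^2^2"
  assumes sym: "transpose A = A"
    and pos: "\<And>v. v \<noteq> 0 \<Longrightarrow> v \<bullet> (A *v v) > 0"
  shows "\<exists>l\<^sub>1 l\<^sub>2. has_eigenvalues A {#l\<^sub>1, l\<^sub>2#} \<and> l\<^sub>1 > 0 \<and> l\<^sub>2 > 0 \<and> l\<^sub>1 + l\<^sub>2 = trace A"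
proof -
  \<comment> \<open>The discriminant \<open>trace\<^sup>2 - 4 det\<close>, written with equal
    off-diagonal entries: a sum of squares, so the quadratic formula yields real roots.\<close>
  define r where "r = sqrt ((A$1$1 - A$2$2)\<^sup>2 + 4 * (A$1$2)\<^sup>2)"
  define l\<^sub>1 where "l\<^sub>1 = (trace A + r) / 2"
  define l\<^sub>2 where "l\<^sub>2 = (trace A - r) / 2"
  have s: "A$2$1 = A$1$2"
    using arg_cong[OF sym, of "\<lambda>B. B$1$2"] by (simp add: transpose_def)
  have r: "r * r = (A$1$1 - A$2$2)\<^sup>2 + 4 * (A$1$2)\<^sup>2"
    by (simp add: r_def)
  have "l\<^sub>1 * l\<^sub>2 = (trace A * trace A - r * r) / 4"
    by (simp add: l\<^sub>1_def l\<^sub>2_def field_simps)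
  also have "\<dots> = A$1$1 * A$2$2 - A$1$2 * A$2$1"
    by (simp add: r s trace_def sum_2 power2_eq_square field_simps)
  finally have prod: "l\<^sub>1 * l\<^sub>2 = A$1$1 * A$2$2 - A$1$2 * A$2$1" .
  have sum: "l\<^sub>1 + l\<^sub>2 = trace A"
    by (simp add: l\<^sub>1_def l\<^sub>2_def field_simps)
  have fac: "char_poly A = [:- l\<^sub>1, 1:] * [:- l\<^sub>2, 1:]"
    unfolding char_poly_2 by (simp add: prod[symmetric] sum[symmetric])
  \<comment> \<open>Evaluating the quadratic form at an eigenvector \<open>v\<close> gives
    \<open>l * (v \<bullet> v)\<close>.\<close>
  have "l > 0" if "l \<in> {l\<^sub>1, l\<^sub>2}" for l
  proof -
    have "eigenvalue A l"
      using that by (intro eigenvalue_if_root_2) (auto simp: fac)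
    then obtain v where v: "v \<noteq> 0" "A *v v = l *\<^sub>R v"
      by (auto simp: eigenvalue_def scalar_mult_eq_scaleR)
    then have "0 < l * (v \<bullet> v)" using pos[of v] by simp
    then show ?thesis using v(1) by (metis inner_gt_zero_iff zero_less_mult_pos2)
  qed
  then show ?thesis using has_eigenvalues_2[OF fac] sum by blast
qed

lemma outer_product_component:
  "((columnvector x :: 'a::comm_semiring_1^1^'m) ** (rowvector y :: 'a^'n^1)) $ i $ j = x $ i * y $ j"
  by (simp add: matrix_matrix_mult_def columnvector_def rowvector_def)

lemma outer_product_mult_vector:
  fixes x :: "real^'m" and v :: "real^'n"
  shows "((columnvector x :: real^1^'m) ** rowvector y) *v v = (y \<bullet> v) *\<^sub>R x"
  by (simp add: vec_eq_iff matrix_vector_mult_def outer_product_component inner_vec_def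
      sum_distrib_left sum_distrib_right mult_ac)

lemma sum_matrix_vector_mult:
  fixes A :: "'i \<Rightarrow> 'a::comm_semiring_1^'n^'m"
  shows "(\<Sum>i\<in>I. A i) *v v = (\<Sum>i\<in>I. A i *v v)"
  by (induction I rule: infinite_finite_induct) (simp_all add: matrix_vector_mult_add_rdistrib)

text \<open>All primaries have the same height \<open>b\<close> along \<open>n\<close>, so every
  difference \<open>a j - a i\<close> has the same normal component and the force sum
  factors.\<close>

lemma normal_component_central_configuration:
  assumes cc: "normalized_central_configuration 3 4 m \<mu> a" and i: "i \<in> {1..4}"
    and b: "\<And>j. j \<in> {1..3} \<Longrightarrow> n \<bullet> a j = b"
  shows "(\<Sum>j\<in>{1..3} - {i}. m j / norm (a j - a i) ^ 3) * (b - n \<bullet> a i) = - (\<mu> * (n \<bullet> a i))"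
proof -
  have "(\<Sum>j\<in>{1..3} - {i}. (m j / norm (a j - a i) ^ 3) *\<^sub>R (a j - a i)) = - (\<mu> *\<^sub>R a i)"
    using cc i by (simp add: normalized_central_configuration_def)
  then have "n \<bullet> (\<Sum>j\<in>{1..3} - {i}. (m j / norm (a j - a i) ^ 3) *\<^sub>R (a j - a i))
      = - (\<mu> * (n \<bullet> a i))"
    by simp
  then show ?thesis
    by (simp add: inner_sum_right inner_diff_right b sum_distrib_right)
qed

lemma sum_inverse_cubes_eq_mu:
  assumes cc: "normalized_central_configuration 3 4 m \<mu> a" and "\<mu> \<noteq> 0"
    and col: "collinear (a ` {1..3})" and noncol: "\<not> collinear (a ` {1..4})"
  shows "(\<Sum>i=1..3. m i / norm (a i - a 4) ^ 3) = \<mu>"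
proof -
  obtain n b where n: "n \<noteq> 0" and b: "\<And>j. j \<in> {1..3} \<Longrightarrow> n \<bullet> a j = b"
    using col unfolding collinear_iff_hyperplane_2 image_subset_iff mem_Collect_eq by metis
  \<comment> \<open>For a primary the factor \<open>b - n \<bullet> a 1\<close> vanishes, leaving
    \<mu> \<open>* b = 0\<close>.\<close>
  have "b = 0"
    using normal_component_central_configuration[OF cc, of 1, OF _ b] b[of 1] \<open>\<mu> \<noteq> 0\<close> by simp
  have "n \<bullet> a 4 \<noteq> 0"
  proof
    assume "n \<bullet> a 4 = 0"
    moreover have "{1..4} = insert 4 {1..3::nat}" by auto
    ultimately have "a ` {1..4} \<subseteq> {x. n \<bullet> x = 0}"
      using b \<open>b = 0\<close> by auto
    then show False using noncol n collinear_iff_hyperplane_2 by blast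
  qed
  moreover have "{1..3} - {4::nat} = {1..3}" by auto
  \<comment> \<open>With \<open>b = 0\<close>, both sides of the equation for body 4 carry the
    nonzero factor \<open>- (n \<bullet> a 4)\<close>, which cancels.\<close>
  ultimately show ?thesis
    using normal_component_central_configuration[OF cc, of 4, OF _ b] \<open>b = 0\<close> by simp
qed

lemma central_configuration_mu_pos:
  assumes cc: "normalized_central_configuration 3 4 m \<mu> a"
    and m: "\<And>i. i \<in> {1..3} \<Longrightarrow> m i > 0"
  shows "\<mu> > 0"
proof -
  have inj: "inj_on a {1..4}"
    and mu: "\<mu> = (\<Sum>i=1..3. \<Sum>j\<in>{i<..3}. m i * m j / norm (a i - a j))"
    using cc by (simp_all add: normalized_central_configuration_def)
  have pos: "m i * m j / norm (a i - a j) > 0" if "i \<in> {1..3}" "j \<in> {i<..3}" for i j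
    using that m[of i] m[of j] inj_onD[OF inj, of i j] by (intro divide_pos_pos) auto
  \<comment> \<open>The inner sum for \<open>i = 3\<close> is empty, so the outer terms are not all
    positive; strictness is taken from \<open>i = 1\<close> alone.\<close>
  have "0 < (\<Sum>j\<in>{1<..3}. m 1 * m j / norm (a 1 - a j))"
    by (rule sum_pos) (use pos[of 1] in auto)
  also have "\<dots> \<le> \<mu>"
    unfolding mu
    by (rule member_le_sum) (use pos in \<open>auto intro!: sum_nonneg intro: less_imp_le\<close>)
  finally show ?thesis .
qed

theorem proposition3p1:
  fixes m :: "nat \<Rightarrow> real" and a :: "nat \<Rightarrow> real^2" and \<mu> :: real
  assumes "m 1 > 0" and "m 2 > 0" and "m 3 > 0"
    and "m 1 + m 2 + m 3 = 1"
    and "m 4 = 0"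
    and "normalized_central_configuration 3 4 m \<mu> a"
    and "euler_configuration m a"
    and "\<not> collinear (a ` {1..4})"
  shows "\<exists>l\<^sub>3 l\<^sub>4. has_eigenvalues (matrix_D m \<mu> a) {#l\<^sub>3, l\<^sub>4#} \<and>
           l\<^sub>3 > 0 \<and> l\<^sub>4 > 0 \<and> l\<^sub>3 + l\<^sub>4 = 3"
proof -
  define d where "d i = a i - a 4" for i
  define w where "w i = m i / norm (d i) ^ 5" for i
  let ?D = "matrix_D m \<mu> a"
  let ?P = "\<lambda>i. (columnvector (d i) :: real^1^2) ** rowvector (d i)"
  have m: "m i > 0" if "i \<in> {1..3}" for i
    using that assms(7) by (simp add: euler_configuration_def)
  have \<mu>: "\<mu> > 0"
    using central_configuration_mu_pos assms(6) m by blast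
  have cubes: "(\<Sum>i=1..3. m i / norm (d i) ^ 3) = \<mu>"
    unfolding d_def using sum_inverse_cubes_eq_mu assms(6-8) \<mu>
    by (simp add: euler_configuration_def)
  \<comment> \<open>By \<open>cubes\<close> the coefficient of the identity matrix is
    \<open>1 -\<close> \<mu>\<open>/\<close>\<mu>\<open>= 0\<close>.\<close>
  have D: "?D = (3 / \<mu>) *\<^sub>R (\<Sum>i=1..3. w i *\<^sub>R ?P i)"
    using cubes \<mu> by (simp add: matrix_D_def d_def w_def)
  have d: "d i \<noteq> 0" if "i \<in> {1..3}" for i
    using that inj_onD[of a "{1..4}" i 4] assms(6)
    by (auto simp: d_def normalized_central_configuration_def)
  then have w: "w i > 0" if "i \<in> {1..3}" for i
    using that m by (simp add: w_def)
  have D_component: "?D $ i $ j = 3 / \<mu> * (\<Sum>k=1..3. w k * (d k $ i * d k $ j))" for i j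
    by (simp add: D outer_product_component)
  have sym: "transpose ?D = ?D"
    by (simp add: vec_eq_iff transpose_def D_component mult.commute)
  have "trace ?D = 3 / \<mu> * (\<Sum>k=1..3. w k * (norm (d k))\<^sup>2)"
    by (simp add: trace_def sum_2 D_component power2_norm_eq_inner inner_vec_def
        sum.distrib distrib_left add_divide_distrib del: sum.cl_ivl_Suc)
  \<comment> \<open>The squared norm lowers the fifth power in \<open>w\<close> to a cube, so
    \<open>cubes\<close> applies again.\<close>
  also have "(\<Sum>k=1..3. w k * (norm (d k))\<^sup>2) = (\<Sum>k=1..3. m k / norm (d k) ^ 3)"
    using d by (intro sum.cong) (auto simp: w_def field_simps power_numeral_reduce)
  finally have trace: "trace ?D = 3"
    using cubes \<mu> by simp
  have "v \<bullet> (?D *v v) > 0" if "v \<noteq> 0" for v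
  proof -
    \<comment> \<open>A nonzero \<open>v\<close> orthogonal to every \<open>d i\<close> would put
      all four points on the level line of \<open>v\<close> through \<open>a 4\<close>. Hence some
      \<open>d k\<close> contributes a positive square to the quadratic form, and the other terms
      are nonnegative.\<close>
    have "\<not> a ` {1..4} \<subseteq> {x. v \<bullet> x = v \<bullet> a 4}"
      using assms(8) \<open>v \<noteq> 0\<close> collinear_iff_hyperplane_2 by blast
    then obtain k where "k \<in> {1..4}" "v \<bullet> a k \<noteq> v \<bullet> a 4"
      by blast
    moreover from this have "k \<noteq> 4" by blast
    ultimately have k: "k \<in> {1..3}" "v \<bullet> d k \<noteq> 0"
      by (auto simp: d_def inner_diff_right)
    have "v \<bullet> (?D *v v) = 3 / \<mu> * (\<Sum>i=1..3. w i * (v \<bullet> d i)\<^sup>2)"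
      by (simp add: D scaleR_matrix_vector_assoc[symmetric] sum_matrix_vector_mult
          outer_product_mult_vector inner_sum_right power2_eq_square inner_commute mult.assoc
          del: sum.cl_ivl_Suc)
    moreover have "0 < (\<Sum>i=1..3. w i * (v \<bullet> d i)\<^sup>2)"
      by (rule sum_pos2[OF _ k(1)]) (use w k in \<open>auto simp: less_imp_le\<close>)
    ultimately show ?thesis using \<mu> by simp
  qed
  then show ?thesis
    using symmetric_positive_definite_2_eigenvalues[OF sym] trace by simp
qed

end
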